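(* Let $V(\mathbf W)=\tfrac12\sum_{k=1}^K\lVert W^k\rVert^2$ for $\mathbf W=(W^1,\dots,W^K)\in\mathbb R^{dK}$, and let $\mathcal L$ be the infinitesimal generator of the process $\{\mathbf W_t\}_{t\ge 0}$ solving, for $k=1,\dots,K$, $$dW^k_t=\Big(-\alpha_{\mathrm{self}}W^k_t+\gamma\sum_{j=1}^K A_{kj}(\Phi-W^j_t)\Big)dt+\sigma_0\,dB^k_t .$$ Then for every $\mathbf W\in\mathbb R^{dK}$, $$\mathcal L V(\mathbf W)=-2\alpha_{\mathrm{self}}V(\mathbf W)+\gamma\sum_{k=1}^K\sum_{j=1}^K A_{kj}\langle W^k,\Phi-W^j\rangle+\tfrac12 Kd\sigma_0^2 .$$
   Context: $K\ge 2$ and $d\ge1$ are integers; $\alpha_{\mathrm{self}}>0$, $\sigma_0>0$, $\gamma\ge 0$ are real constants. $A\in\mathbb R^{K\times K}$ satisfies $A_{kj}\ge 0$ for all $k,j$, $A_{kk}=0$ for all $k$, and $\sum_{j=1}^K A_{kj}=1$ for all $k$. $\Phi\in\mathbb R^d$ is a fixed vector with $\lVert\Phi\rVert\le\Phi_{\max}<\infty$. $B^1,\dots,B^K$ are mutually independent standard $d$-dimensional Brownian motions on a complete filtered probability space satisfying the usual conditions. $\lVert\cdot\rVert$ and $\langle\cdot,\cdot\rangle$ are the Euclidean norm and inner product. The state is $\mathbf W_t=(W^1_t,\dots,W^K_t)\in\mathbb R^{dK}$. (The drift term $-\alpha_{\mathrm{self}}W^k$ is minus the gradient of the loss $\tfrac12\alpha_{\mathrm{self}}\lVert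 w\rVert^2$ of agent $k$.) Write $\mu^k(\mathbf W)=-\alpha_{\mathrm{self}}W^k+\gamma\sum_j A_{kj}(\Phi-W^j)$. The infinitesimal generator is $\mathcal L f(\mathbf W)=\lim_{t\downarrow0}\big(\mathbb E_{\mathbf W}[f(\mathbf W_t)]-f(\mathbf W)\big)/t$, which by Itô's formula takes the form $\mathcal L f(\mathbf W)=\sum_{k=1}^K\big[\langle\mu^k(\mathbf W),\nabla_{W^k}f(\mathbf W)\rangle+\tfrac{\sigma_0^2}{2}\Delta_{W^k}f(\mathbf W)\big]$ for $f\in C^2(\mathbb R^{dK})$, where $\Delta_{W^k}$ is the Laplacian in the variable $W^k$. *)

theory Defs
  imports "HOL-Probability.Probability"
begin

text \<open>
  The time set is \<open>[0, \<infinity>)\<close>, represented by the nonnegative reals; values of processes and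
  filtrations at negative times are unconstrained.  The state space of \<open>K\<close> agents in dimension
  \<open>d\<close> is \<open>real ^ 'd ^ 'k\<close> with \<open>K = CARD('k)\<close> and \<open>d = CARD('d)\<close>; \<open>w $ k\<close> is the block \<open>W\<^sup>k\<close>.
\<close>

definition usual_filtration :: "'a measure \<Rightarrow> (real \<Rightarrow> 'a measure) \<Rightarrow> bool" where
  "usual_filtration M F \<longleftrightarrow>
     complete_measure M \<and>
     (\<forall>t\<ge>0. subalgebra M (F t)) \<and>
     (\<forall>s\<ge>0. \<forall>t\<ge>s. subalgebra (F t) (F s)) \<and>
     null_sets M \<subseteq> sets (F 0) \<and>
     (\<forall>t\<ge>0. sets (F t) = (\<Inter>s\<in>{t<..}. sets (F s)))"

definition adapted :: "(real \<Rightarrow> 'a measure) \<Rightarrow> (real \<Rightarrow> 'a \<Rightarrow> 'b::topological_space) \<Rightarrow> bool" where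
  "adapted F X \<longleftrightarrow> (\<forall>t\<ge>0. X t \<in> borel_measurable (F t))"

definition as_continuous :: "'a measure \<Rightarrow> (real \<Rightarrow> 'a \<Rightarrow> 'b::topological_space) \<Rightarrow> bool" where
  "as_continuous M X \<longleftrightarrow> (AE \<omega> in M. continuous_on {0..} (\<lambda>t. X t \<omega>))"

text \<open>
  Standard Brownian motion in \<open>real ^ 'd\<close> relative to \<open>F\<close>.  The increment over \<open>[s, t]\<close> has law
  \<open>N(0, (t - s) I)\<close>, i.e. independent centred normal coordinates of variance \<open>t - s\<close>
  (\<^const>\<open>normal_density\<close> takes the mean and the standard deviation).
\<close>

definition standard_brownian_motion ::
    "'a measure \<Rightarrow> (real \<Rightarrow> 'a measure) \<Rightarrow> (real \<Rightarrow> 'a \<Rightarrow> real ^ 'd) \<Rightarrow> bool" where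
  "standard_brownian_motion M F B \<longleftrightarrow>
     adapted F B \<and> as_continuous M B \<and> (AE \<omega> in M. B 0 \<omega> = 0) \<and>
     (\<forall>s\<ge>0. \<forall>t>s.
        prob_space.indep_set M (sets (F s))
          (sets (vimage_algebra (space M) (\<lambda>\<omega>. B t \<omega> - B s \<omega>) borel)) \<and>
        prob_space.indep_vars M (\<lambda>_. borel) (\<lambda>i \<omega>. (B t \<omega> - B s \<omega>) $ i) UNIV \<and>
        (\<forall>i. distributed M lborel (\<lambda>\<omega>. (B t \<omega> - B s \<omega>) $ i) (normal_density 0 (sqrt (t - s)))))"

text \<open>Mutual independence of whole processes, as random elements of the path space.\<close>

definition independent_processes ::
    "'a measure \<Rightarrow> ('k \<Rightarrow> real \<Rightarrow> 'a \<Rightarrow> 'b::topological_space) \<Rightarrow> bool" where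
  "independent_processes M B \<longleftrightarrow>
     prob_space.indep_vars M (\<lambda>_. PiM {0..} (\<lambda>_. borel)) (\<lambda>k \<omega>. \<lambda>t\<in>{0..}. B k t \<omega>) UNIV"

definition drift ::
    "real \<Rightarrow> real \<Rightarrow> real ^ 'k ^ 'k \<Rightarrow> real ^ 'd \<Rightarrow> real ^ 'd ^ 'k \<Rightarrow> 'k::finite \<Rightarrow> real ^ 'd" where
  "drift \<alpha> \<gamma> A \<Phi> w k = - \<alpha> *\<^sub>R w $ k + \<gamma> *\<^sub>R (\<Sum>j\<in>UNIV. A $ k $ j *\<^sub>R (\<Phi> - w $ j))"

text \<open>
  Strong solution, started at \<open>w\<close>, of \<open>dW\<^sup>k = \<mu> W k dt + \<sigma> dB\<^sup>k\<close>.  The SDE is read in its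
  integral form; the diffusion coefficient is constant, so the stochastic integral is
  \<open>\<sigma> (B\<^sup>k t - B\<^sup>k 0)\<close>.
\<close>

definition solves_sde ::
    "'a measure \<Rightarrow> (real \<Rightarrow> 'a measure) \<Rightarrow> ('k \<Rightarrow> real \<Rightarrow> 'a \<Rightarrow> real ^ 'd) \<Rightarrow>
     (real ^ 'd ^ 'k \<Rightarrow> 'k::finite \<Rightarrow> real ^ 'd) \<Rightarrow> real \<Rightarrow> real ^ 'd ^ 'k \<Rightarrow>
     (real \<Rightarrow> 'a \<Rightarrow> real ^ 'd ^ 'k) \<Rightarrow> bool" where
  "solves_sde M F B \<mu> \<sigma> w W \<longleftrightarrow>
     adapted F W \<and> as_continuous M W \<and> (AE \<omega> in M. W 0 \<omega> = w) \<and>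
     (AE \<omega> in M. \<forall>t\<ge>0. \<forall>k.
        W t \<omega> $ k = W 0 \<omega> $ k + integral {0..t} (\<lambda>s. \<mu> (W s \<omega>) k)
          + \<sigma> *\<^sub>R (B k t \<omega> - B k 0 \<omega>))"

text \<open>
  For a process family \<open>X\<close>, where \<open>X w\<close> is the process started at \<open>w\<close>, the infinitesimal generator
  applied to \<open>f\<close> has the value \<open>l\<close> at \<open>w\<close>: the limit of
  \<open>(E\<^sub>w[f(W\<^sub>t)] - f(w)) / t\<close> as \<open>t\<close> decreases to \<open>0\<close> exists and equals \<open>l\<close>.  Integrability is
  required because the Bochner integral of a non-integrable function is \<open>0\<close> by convention.
\<close>

definition has_generator_value ::
    "'a measure \<Rightarrow> ('s \<Rightarrow> real \<Rightarrow> 'a \<Rightarrow> 's) \<Rightarrow> ('s \<Rightarrow> real) \<Rightarrow> 's \<Rightarrow> real \<Rightarrow> bool" where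
  "has_generator_value M X f w l \<longleftrightarrow>
     (\<forall>\<^sub>F t in at_right 0. integrable M (\<lambda>\<omega>. f (X w t \<omega>))) \<and>
     ((\<lambda>t. ((\<integral>\<omega>. f (X w t \<omega>) \<partial>M) - f w) / t) \<longlongrightarrow> l) (at_right 0)"

definition V :: "real ^ 'd ^ 'k::finite \<Rightarrow> real" where
  "V w = 1 / 2 * (\<Sum>k\<in>UNIV. (norm (w $ k))\<^sup>2)"

end

theory Submission
  imports Defs
begin

text \<open>
  The noise is additive, so the value of the generator on \<open>V w = \<parallel>w\<parallel>\<^sup>2 / 2\<close> can be read off from a
  second order expansion of \<open>\<parallel>W\<^sub>t\<parallel>\<^sup>2\<close> at \<open>t = 0\<close>, without stochastic integration.  Let \<open>b\<close> be the drift
  as a vector field on the whole state space and \<open>Z\<^sub>t\<close> the scaled Brownian increment.  The integral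
  form of the equation says
  \<open>W\<^sub>t = w + t b(w) + R\<^sub>t + Z\<^sub>t\<close>, where \<open>R\<^sub>t = \<integral>\<^sub>0\<^sup>t (b(W\<^sub>s) - b(w)) ds\<close>.  In the expansion of
  \<open>\<parallel>W\<^sub>t\<parallel>\<^sup>2 / 2\<close>, the terms linear in \<open>Z\<^sub>t\<close> have mean \<open>0\<close>, the term \<open>\<parallel>Z\<^sub>t\<parallel>\<^sup>2 / 2\<close> has mean
  \<open>t K d \<sigma>\<^sub>0\<^sup>2 / 2\<close>, and \<open>t \<langle>w, b(w)\<rangle>\<close> is \<open>t\<close> times the drift part of the claim.

  Everything else is \<open>o(t)\<close> as soon as \<open>\<bbbE> \<parallel>R\<^sub>t\<parallel>\<^sup>2 = O(t\<^sup>3)\<close>: the largest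
  remaining term \<open>\<langle>w, R\<^sub>t\<rangle>\<close> then has mean at most of order \<open>t\<^bsup>3/2\<^esup>\<close>, and \<open>\<langle>R\<^sub>t, Z\<^sub>t\<rangle>\<close> has mean at most of order
  \<open>t\<^bsup>3/2\<^esup> t\<^bsup>1/2\<^esup> = t\<^sup>2\<close>.  Since \<open>b\<close> is affine, it is Lipschitz, and Gronwall's inequality
  bounds \<open>\<parallel>R\<^sub>t\<parallel>\<close> path by path by a multiple of \<open>\<integral>\<^sub>0\<^sup>t (s \<parallel>b(w)\<parallel> + \<parallel>Z\<^sub>s\<parallel>) ds\<close>
  (\<open>additive_noise_remainder_le\<close>).  The integrand has second moment \<open>O(t)\<close> on \<open>[0, t]\<close>, so its time
  integral has second moment \<open>t\<^sup>2 O(t)\<close> (\<open>nn_integral_square_time_integral_le\<close>).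
\<close>

section \<open>Integrals of continuous paths\<close>

text \<open>
  Riemann sums turn the time integral of a random path into a limit of finite sums of random
  variables, for which moments are computable term by term.
\<close>

lemma riemann_sums_tendsto_integral:
  fixes g :: "real \<Rightarrow> real"
  assumes t: "0 \<le> t" and g: "continuous_on {0..t} g"
  shows "(\<lambda>n. \<Sum>i<n. t / real n * g (t * real i / real n)) \<longlonglongrightarrow> integral {0..t} g"
proof (rule LIMSEQ_I)
  fix e :: real assume "0 < e"
  define e' where "e' = e / (2 * (t + 1))"
  have e': "e' > 0" using \<open>0 < e\<close> t by (simp add: e'_def)
  have "uniformly_continuous_on {0..t} g"
    using g by (intro compact_uniformly_continuous) auto
  then obtain d where d: "d > 0"
    and close: "\<And>x y. x \<in> {0..t} \<Longrightarrow> y \<in> {0..t} \<Longrightarrow> dist x y < d \<Longrightarrow> dist (g x) (g y) < e'"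
    using e' unfolding uniformly_continuous_on_def by metis
  obtain N :: nat where N: "N > 0" "t / d < N"
    by (metis reals_Archimedean2 gr0I of_nat_0_less_iff less_trans linorder_not_less of_nat_0 t d divide_nonneg_pos)
  show "\<exists>N. \<forall>n\<ge>N. norm ((\<Sum>i<n. t / real n * g (t * real i / real n)) - integral {0..t} g) < e"
  proof (intro exI allI impI)
    fix n assume "N \<le> n"
    then have n: "n > 0" "t / d < n" using N by auto
    then have mesh: "t / n < d" using d by (simp add: field_simps)
    have point: "t * real i / n \<in> {0..t}" if "i \<le> n" for i
      using t n that by (auto simp: field_simps intro!: mult_left_mono)
    have mono: "t * real i / n \<le> t * real (Suc i) / n" for i
      using t n by (intro divide_right_mono mult_left_mono) auto
    have partial: "\<bar>(\<Sum>i<m. t / real n * g (t * real i / real n)) - integral {0..t * m / n} g\<bar> \<le> m * (t / n * e')"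
      if "m \<le> n" for m
      using that
    proof (induction m)
      case 0
      then show ?case by simp
    next
      case (Suc m)
      let ?a = "t * real m / n" and ?b = "t * real (Suc m) / n"
      have ab: "?a \<in> {0..t}" "?b \<in> {0..t}" "?a \<le> ?b" "?b - ?a = t / n"
        using point[of m] point[of "Suc m"] Suc.prems mono[of m]
        by (auto simp: diff_divide_distrib[symmetric] algebra_simps)
      have int: "g integrable_on {0..?b}" "g integrable_on {?a..?b}"
        using g ab by (auto intro!: integrable_continuous_real intro: continuous_on_subset)
      have split: "integral {0..?b} g = integral {0..?a} g + integral {?a..?b} g"
        using ab int by (intro Henstock_Kurzweil_Integration.integral_combine[symmetric]) auto
      have "t / n * g ?a - integral {?a..?b} g = integral {?a..?b} (\<lambda>x. g ?a - g x)"
        using ab int by (subst integral_diff) auto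
      also have "\<bar>\<dots>\<bar> \<le> e' * (?b - ?a)"
        unfolding real_norm_def[symmetric]
      proof (rule integral_bound)
        show "continuous_on {?a..?b} (\<lambda>x. g ?a - g x)"
          using g ab by (auto intro!: continuous_intros intro: continuous_on_subset)
        fix x assume x: "x \<in> {?a..?b}"
        then have "dist ?a x < d" using ab(4) mesh by (auto simp: dist_real_def)
        then have "dist (g ?a) (g x) < e'" using x ab by (intro close) auto
        then show "norm (g ?a - g x) \<le> e'" by (simp add: dist_norm)
      qed (use ab in auto)
      finally have "\<bar>t / n * g ?a - integral {?a..?b} g\<bar> \<le> t / n * e'"
        using ab(4) by (simp add: mult.commute)
      moreover have "real (Suc m) * (t / real n * e') = real m * (t / real n * e') + t / real n * e'"
        by (simp add: distrib_right add_divide_distrib)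
      ultimately show ?case
        using Suc.IH[OF Suc_leD[OF Suc.prems]] unfolding sum.lessThan_Suc split by linarith
    qed
    have "\<bar>(\<Sum>i<n. t / real n * g (t * real i / real n)) - integral {0..t} g\<bar> \<le> t * e'"
      using partial[of n] n by simp
    also have "\<dots> \<le> (t + 1) * e'" using e' by simp
    also have "\<dots> = e / 2" using t by (simp add: e'_def field_simps)
    also have "\<dots> < e" using \<open>0 < e\<close> by simp
    finally show "norm ((\<Sum>i<n. t / real n * g (t * real i / real n)) - integral {0..t} g) < e"
      by simp
  qed
qed

text \<open>
  Gronwall's inequality for the integrated unknown: \<open>J s = integral {0..s} u\<close> satisfies
  \<open>J' \<le> g + L J\<close>, so \<open>exp (- L s) J s\<close> grows no faster than the integral of \<open>g\<close>.
\<close>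

lemma integral_gronwall:
  fixes u g :: "real \<Rightarrow> real"
  assumes t: "0 \<le> t" and L: "0 \<le> L"
    and u: "continuous_on {0..t} u" and g: "continuous_on {0..t} g"
    and g_nonneg: "\<And>s. s \<in> {0..t} \<Longrightarrow> 0 \<le> g s"
    and le: "\<And>s. s \<in> {0..t} \<Longrightarrow> u s \<le> g s + L * integral {0..s} u"
  shows "integral {0..t} u \<le> exp (L * t) * integral {0..t} g"
proof -
  define D where "D s = exp (- L * s) * integral {0..s} u - integral {0..s} g" for s
  have "D t \<le> D 0"
  proof (rule DERIV_nonpos_imp_decreasing_open[OF t])
    show "continuous_on {0..t} D"
      unfolding D_def using u g
      by (intro continuous_intros indefinite_integral_continuous_1 integrable_continuous_real)
    fix s assume s: "0 < s" "s < t"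
    have at: "at s within {0..t} = at s" using s by (intro at_within_interior) auto
    have "((\<lambda>s. integral {0..s} u) has_real_derivative u s) (at s)"
         "((\<lambda>s. integral {0..s} g) has_real_derivative g s) (at s)"
      using integral_has_real_derivative[OF u, of s] integral_has_real_derivative[OF g, of s] s at
      by auto
    then have "(D has_real_derivative exp (- L * s) * (u s - L * integral {0..s} u) - g s) (at s)"
      unfolding D_def by (auto intro!: derivative_eq_intros simp: algebra_simps)
    moreover have "exp (- L * s) * (u s - L * integral {0..s} u) \<le> exp (- L * s) * g s"
      using le[of s] s by (intro mult_left_mono) auto
    moreover have "exp (- L * s) * g s \<le> 1 * g s"
      using g_nonneg[of s] s L by (intro mult_right_mono) auto
    ultimately show "\<exists>y. (D has_real_derivative y) (at s) \<and> y \<le> 0"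
      by (intro exI conjI) (assumption, linarith)
  qed
  then have "exp (- L * t) * integral {0..t} u \<le> integral {0..t} g" by (simp add: D_def)
  then have "exp (L * t) * (exp (- L * t) * integral {0..t} u) \<le> exp (L * t) * integral {0..t} g"
    by (intro mult_left_mono) auto
  then show ?thesis by (simp add: mult.assoc[symmetric] exp_add[symmetric])
qed

text \<open>
  By the Cauchy--Schwarz inequality the bound holds for the Riemann sums of the path, and Fatou's
  lemma carries it to the integral.  The Riemann sums see \<open>g\<close> only at fixed times, so measurability
  at each time and almost sure continuity suffice.
\<close>

lemma nn_integral_square_time_integral_le:
  fixes g :: "real \<Rightarrow> 'a \<Rightarrow> real"
  assumes t: "0 \<le> t"
    and meas: "\<And>s. s \<in> {0..t} \<Longrightarrow> g s \<in> borel_measurable M"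
    and cont: "AE \<omega> in M. continuous_on {0..t} (\<lambda>s. g s \<omega>)"
    and le: "\<And>s. s \<in> {0..t} \<Longrightarrow> (\<integral>\<^sup>+\<omega>. ennreal ((g s \<omega>)\<^sup>2) \<partial>M) \<le> ennreal c"
  shows "(\<integral>\<^sup>+\<omega>. ennreal ((integral {0..t} (\<lambda>s. g s \<omega>))\<^sup>2) \<partial>M) \<le> ennreal (t\<^sup>2 * c)"
proof -
  define S where "S n \<omega> = (\<Sum>i<n. t / real n * g (t * real i / n) \<omega>)" for n \<omega>
  have point: "t * real i / n \<in> {0..t}" if "i < n" for i n
    using t that by (auto simp: field_simps intro!: mult_left_mono)
  have S_meas: "S n \<in> borel_measurable M" for n
    unfolding S_def by (intro borel_measurable_sum borel_measurable_times meas point) auto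
  have S_le: "(\<integral>\<^sup>+\<omega>. ennreal ((S n \<omega>)\<^sup>2) \<partial>M) \<le> ennreal (t\<^sup>2 * c)" for n
  proof -
    have sq_meas: "(\<lambda>\<omega>. ennreal ((g (t * real i / real n) \<omega>)\<^sup>2)) \<in> borel_measurable M" if "i < n" for i
      using meas[OF point[OF that]] by measurable
    have "(S n \<omega>)\<^sup>2 \<le> (\<Sum>i<n. t\<^sup>2 / real n * (g (t * real i / real n) \<omega>)\<^sup>2)" for \<omega>
    proof -
      have "(S n \<omega>)\<^sup>2 \<le> (\<Sum>i<n. (t / real n * g (t * real i / n) \<omega>)\<^sup>2) * card {..<n}"
        unfolding S_def by (rule sum_squared_le_sum_of_squares)
      also have "\<dots> = (\<Sum>i<n. t\<^sup>2 / real n * (g (t * real i / real n) \<omega>)\<^sup>2)"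
        by (simp add: sum_distrib_right power_mult_distrib power_divide)
           (simp add: power2_eq_square)
      finally show ?thesis .
    qed
    then have "(\<integral>\<^sup>+\<omega>. ennreal ((S n \<omega>)\<^sup>2) \<partial>M) \<le>
        (\<integral>\<^sup>+\<omega>. ennreal (\<Sum>i<n. t\<^sup>2 / real n * (g (t * real i / real n) \<omega>)\<^sup>2) \<partial>M)"
      by (intro nn_integral_mono ennreal_leI)
    also have "\<dots> = (\<integral>\<^sup>+\<omega>. (\<Sum>i<n. ennreal (t\<^sup>2 / n) * ennreal ((g (t * real i / real n) \<omega>)\<^sup>2)) \<partial>M)"
      by (simp add: sum_ennreal[symmetric] ennreal_mult'[symmetric] del: sum_ennreal)
    also have "\<dots> = (\<Sum>i<n. \<integral>\<^sup>+\<omega>. ennreal (t\<^sup>2 / n) * ennreal ((g (t * real i / real n) \<omega>)\<^sup>2) \<partial>M)"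
      using sq_meas by (intro nn_integral_sum borel_measurable_times) auto
    also have "\<dots> = (\<Sum>i<n. ennreal (t\<^sup>2 / n) * \<integral>\<^sup>+\<omega>. ennreal ((g (t * real i / real n) \<omega>)\<^sup>2) \<partial>M)"
      using sq_meas by (intro sum.cong nn_integral_cmult refl) auto
    also have "\<dots> \<le> (\<Sum>i<n. ennreal (t\<^sup>2 / n) * ennreal c)"
      by (intro sum_mono mult_left_mono le point) auto
    also have "\<dots> \<le> ennreal (t\<^sup>2 * c)"
      by (cases "n = 0")
         (auto simp: ennreal_of_nat_eq_real_of_nat ennreal_mult'[symmetric] mult.assoc[symmetric])
    finally show ?thesis .
  qed
  have "(\<integral>\<^sup>+\<omega>. ennreal ((integral {0..t} (\<lambda>s. g s \<omega>))\<^sup>2) \<partial>M)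
      \<le> (\<integral>\<^sup>+\<omega>. liminf (\<lambda>n. ennreal ((S n \<omega>)\<^sup>2)) \<partial>M)"
  proof (rule nn_integral_mono_AE, use cont in eventually_elim)
    fix \<omega> assume "continuous_on {0..t} (\<lambda>s. g s \<omega>)"
    then have "(\<lambda>n. S n \<omega>) \<longlonglongrightarrow> integral {0..t} (\<lambda>s. g s \<omega>)"
      unfolding S_def by (rule riemann_sums_tendsto_integral[OF t])
    then have "(\<lambda>n. ennreal ((S n \<omega>)\<^sup>2)) \<longlonglongrightarrow> ennreal ((integral {0..t} (\<lambda>s. g s \<omega>))\<^sup>2)"
      by (intro tendsto_intros)
    then show "ennreal ((integral {0..t} (\<lambda>s. g s \<omega>))\<^sup>2) \<le> liminf (\<lambda>n. ennreal ((S n \<omega>)\<^sup>2))"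
      using lim_imp_Liminf by force
  qed
  also have "\<dots> \<le> liminf (\<lambda>n. \<integral>\<^sup>+\<omega>. ennreal ((S n \<omega>)\<^sup>2) \<partial>M)"
    using S_meas by (intro nn_integral_liminf) auto
  also have "\<dots> \<le> liminf (\<lambda>n. ennreal (t\<^sup>2 * c))"
    by (intro Liminf_mono always_eventually allI S_le)
  also have "\<dots> = ennreal (t\<^sup>2 * c)" by (simp add: Liminf_const)
  finally show ?thesis .
qed

section \<open>Short time expansion under additive noise\<close>

text \<open>
  The remainder is the integral of \<open>b (x r) - b w\<close>, hence at most \<open>L\<close> times the integral of the
  displacement \<open>norm (x r - w)\<close>.  The displacement is at most the forcing
  \<open>s * norm (b w) + norm (z s)\<close> plus the remainder, which is the situation of Gronwall's inequality.
\<close>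

lemma additive_noise_remainder_le:
  fixes x z :: "real \<Rightarrow> 'e::euclidean_space"
  assumes t: "0 \<le> t" and lip: "L-lipschitz_on UNIV b"
    and x: "continuous_on {0..t} x" and z: "continuous_on {0..t} z"
    and eq: "\<And>s. s \<in> {0..t} \<Longrightarrow> x s = w + integral {0..s} (\<lambda>r. b (x r)) + z s"
  shows "norm (x t - w - t *\<^sub>R b w - z t)
    \<le> L * exp (L * t) * integral {0..t} (\<lambda>s. s * norm (b w) + norm (z s))"
proof -
  have L: "0 \<le> L" using lip by (rule lipschitz_on_nonneg)
  have lip': "norm (b y - b y') \<le> L * norm (y - y')" for y y'
    using lipschitz_onD[OF lip, of y y'] by (simp add: dist_norm)
  define u where "u s = norm (x s - w)" for s
  have u: "continuous_on {0..t} u" unfolding u_def using x by (intro continuous_intros)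
  have bx: "continuous_on {0..t} (\<lambda>r. b (x r))"
    using continuous_on_compose2[OF lipschitz_on_continuous_on[OF lip] x] by simp
  have remainder: "norm (x s - w - s *\<^sub>R b w - z s) \<le> L * integral {0..s} u" if s: "s \<in> {0..t}" for s
  proof -
    have bx_s: "(\<lambda>r. b (x r)) integrable_on {0..s}" and u_s: "u integrable_on {0..s}"
      using bx u s by (auto intro!: integrable_continuous_real intro: continuous_on_subset)
    have "x s - w - s *\<^sub>R b w - z s = integral {0..s} (\<lambda>r. b (x r) - b w)"
      using eq[OF s] s bx_s by (subst integral_diff) auto
    also have "norm \<dots> \<le> integral {0..s} (\<lambda>r. L * u r)"
      using bx_s u_s lip' unfolding u_def
      by (intro integral_norm_bound_integral integrable_diff integrable_on_mult_right) auto
    also have "\<dots> = L * integral {0..s} u" by simp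
    finally show ?thesis .
  qed
  have "integral {0..t} u \<le> exp (L * t) * integral {0..t} (\<lambda>s. s * norm (b w) + norm (z s))"
  proof (rule integral_gronwall[OF t L u])
    show "continuous_on {0..t} (\<lambda>s. s * norm (b w) + norm (z s))"
      using z by (intro continuous_intros)
    fix s assume s: "s \<in> {0..t}"
    then show "0 \<le> s * norm (b w) + norm (z s)" by auto
    have "u s = norm ((x s - w - s *\<^sub>R b w - z s) + (s *\<^sub>R b w + z s))" by (simp add: u_def)
    also have "\<dots> \<le> norm (x s - w - s *\<^sub>R b w - z s) + (norm (s *\<^sub>R b w) + norm (z s))"
      by (intro order.trans[OF norm_triangle_ineq] add_left_mono norm_triangle_ineq)
    also have "norm (s *\<^sub>R b w) = s * norm (b w)" using s by simp
    finally show "u s \<le> s * norm (b w) + norm (z s) + L * integral {0..s} u"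
      using remainder[OF s] by simp
  qed
  then have "L * integral {0..t} u
      \<le> L * (exp (L * t) * integral {0..t} (\<lambda>s. s * norm (b w) + norm (z s)))"
    using L by (rule mult_left_mono)
  moreover have "norm (x t - w - t *\<^sub>R b w - z t) \<le> L * integral {0..t} u"
    using t by (intro remainder) auto
  ultimately show ?thesis by (simp add: mult.assoc)
qed

text \<open>
  Combines the pathwise bound with the second moment of time integrals: the forcing has second
  moment of order \<open>t\<close>, and squaring an integral over \<open>[0, t]\<close> contributes another \<open>t\<^sup>2\<close>.  The
  restriction \<open>t \<le> 1\<close> makes the constant independent of \<open>t\<close>.
\<close>

lemma (in prob_space) additive_noise_remainder_second_moment:
  fixes X Z :: "real \<Rightarrow> 'a \<Rightarrow> 'e::euclidean_space"
  assumes t: "0 \<le> t" "t \<le> 1" and lip: "L-lipschitz_on UNIV b"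
    and X_meas: "X t \<in> borel_measurable M"
    and Z_meas: "\<And>s. 0 \<le> s \<Longrightarrow> Z s \<in> borel_measurable M"
    and X_cont: "AE \<omega> in M. continuous_on {0..} (\<lambda>s. X s \<omega>)"
    and Z_cont: "AE \<omega> in M. continuous_on {0..} (\<lambda>s. Z s \<omega>)"
    and eq: "AE \<omega> in M. \<forall>s\<ge>0. X s \<omega> = w + integral {0..s} (\<lambda>r. b (X r \<omega>)) + Z s \<omega>"
    and Z_int: "\<And>s. 0 \<le> s \<Longrightarrow> integrable M (\<lambda>\<omega>. (norm (Z s \<omega>))\<^sup>2)"
    and Z_var: "\<And>s. 0 \<le> s \<Longrightarrow> expectation (\<lambda>\<omega>. (norm (Z s \<omega>))\<^sup>2) = v * s" and v: "0 \<le> v"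
  defines "R \<equiv> \<lambda>\<omega>. X t \<omega> - w - t *\<^sub>R b w - Z t \<omega>"
    and "C \<equiv> 2 * (L * exp L)\<^sup>2 * ((norm (b w))\<^sup>2 + v)"
  shows "integrable M (\<lambda>\<omega>. (norm (R \<omega>))\<^sup>2)"
    and "expectation (\<lambda>\<omega>. (norm (R \<omega>))\<^sup>2) \<le> C * t ^ 3"
proof -
  define K where "K = L * exp L"
  define g where "g s \<omega> = K * (s * norm (b w) + norm (Z s \<omega>))" for s \<omega>
  have L: "0 \<le> L" using lip by (rule lipschitz_on_nonneg)
  then have K: "0 \<le> K" by (simp add: K_def)
  have C: "0 \<le> C" using v by (simp add: C_def)
  have "(\<integral>\<^sup>+\<omega>. ennreal ((norm (R \<omega>))\<^sup>2) \<partial>M)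
      \<le> (\<integral>\<^sup>+\<omega>. ennreal ((integral {0..t} (\<lambda>s. g s \<omega>))\<^sup>2) \<partial>M)"
  proof (rule nn_integral_mono_AE, use X_cont Z_cont eq in eventually_elim)
    fix \<omega> assume cont: "continuous_on {0..} (\<lambda>s. X s \<omega>)" "continuous_on {0..} (\<lambda>s. Z s \<omega>)"
      and eq: "\<forall>s\<ge>0. X s \<omega> = w + integral {0..s} (\<lambda>r. b (X r \<omega>)) + Z s \<omega>"
    have z: "continuous_on {0..t} (\<lambda>s. Z s \<omega>)" using cont by (auto intro: continuous_on_subset)
    let ?I = "integral {0..t} (\<lambda>s. s * norm (b w) + norm (Z s \<omega>))"
    have I: "0 \<le> ?I"
      using z by (intro integral_nonneg integrable_continuous_real continuous_intros) auto
    have "norm (R \<omega>) \<le> L * exp (L * t) * ?I"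
      unfolding R_def using cont eq t
      by (intro additive_noise_remainder_le[OF _ lip]) (auto intro: continuous_on_subset)
    also have "\<dots> \<le> K * ?I"
      unfolding K_def using L t I by (intro mult_right_mono mult_left_mono) (auto simp: mult_left_le)
    also have "\<dots> = integral {0..t} (\<lambda>s. g s \<omega>)" by (simp add: g_def)
    finally show "ennreal ((norm (R \<omega>))\<^sup>2) \<le> ennreal ((integral {0..t} (\<lambda>s. g s \<omega>))\<^sup>2)"
      by (intro ennreal_leI power_mono) auto
  qed
  also have "\<dots> \<le> ennreal (t\<^sup>2 * (C * t))"
  proof (rule nn_integral_square_time_integral_le[OF t(1)])
    show "g s \<in> borel_measurable M" if "s \<in> {0..t}" for s
      using Z_meas[of s] that unfolding g_def by simp
    show "AE \<omega> in M. continuous_on {0..t} (\<lambda>s. g s \<omega>)"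
      using Z_cont unfolding g_def
      by eventually_elim (auto intro!: continuous_intros intro: continuous_on_subset)
    fix s assume s: "s \<in> {0..t}"
    have g_sq: "(g s \<omega>)\<^sup>2 \<le> 2 * K\<^sup>2 * (s\<^sup>2 * (norm (b w))\<^sup>2 + (norm (Z s \<omega>))\<^sup>2)" for \<omega>
    proof -
      have "(s * norm (b w) + norm (Z s \<omega>))\<^sup>2 \<le> 2 * ((s * norm (b w))\<^sup>2 + (norm (Z s \<omega>))\<^sup>2)"
        by (smt (verit) sum_squares_bound power2_sum)
      then have "K\<^sup>2 * (s * norm (b w) + norm (Z s \<omega>))\<^sup>2
          \<le> K\<^sup>2 * (2 * ((s * norm (b w))\<^sup>2 + (norm (Z s \<omega>))\<^sup>2))" by (intro mult_left_mono) auto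
      then show ?thesis unfolding g_def power_mult_distrib by (simp add: algebra_simps)
    qed
    have int: "integrable M (\<lambda>\<omega>. 2 * K\<^sup>2 * (s\<^sup>2 * (norm (b w))\<^sup>2 + (norm (Z s \<omega>))\<^sup>2))"
      using Z_int[of s] s by (intro integrable_mult_right integrable_add) auto
    have "(\<integral>\<^sup>+\<omega>. ennreal ((g s \<omega>)\<^sup>2) \<partial>M)
        \<le> (\<integral>\<^sup>+\<omega>. ennreal (2 * K\<^sup>2 * (s\<^sup>2 * (norm (b w))\<^sup>2 + (norm (Z s \<omega>))\<^sup>2)) \<partial>M)"
      by (intro nn_integral_mono ennreal_leI g_sq)
    also have "\<dots> = ennreal (2 * K\<^sup>2 * (s\<^sup>2 * (norm (b w))\<^sup>2 + v * s))"
      using Z_int[of s] Z_var[of s] s by (subst nn_integral_eq_integral[OF int]) (auto simp: prob_space)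
    also have "\<dots> \<le> ennreal (C * t)"
    proof (rule ennreal_leI)
      have "s\<^sup>2 \<le> t" using s t by (auto simp: power2_eq_square intro: order.trans[OF mult_left_le])
      then have "s\<^sup>2 * (norm (b w))\<^sup>2 + v * s \<le> t * (norm (b w))\<^sup>2 + v * t"
        using s v by (intro add_mono mult_right_mono mult_left_mono) auto
      then have "2 * K\<^sup>2 * (s\<^sup>2 * (norm (b w))\<^sup>2 + v * s) \<le> 2 * K\<^sup>2 * (t * (norm (b w))\<^sup>2 + v * t)"
        by (intro mult_left_mono) auto
      also have "\<dots> = C * t" by (simp add: C_def K_def algebra_simps)
      finally show "2 * K\<^sup>2 * (s\<^sup>2 * (norm (b w))\<^sup>2 + v * s) \<le> C * t" .
    qed
    finally show "(\<integral>\<^sup>+\<omega>. ennreal ((g s \<omega>)\<^sup>2) \<partial>M) \<le> ennreal (C * t)" .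
  qed
  also have "t\<^sup>2 * (C * t) = C * t ^ 3" by (simp add: power2_eq_square power3_eq_cube)
  finally have le: "(\<integral>\<^sup>+\<omega>. ennreal ((norm (R \<omega>))\<^sup>2) \<partial>M) \<le> ennreal (C * t ^ 3)" .
  have R_meas: "R \<in> borel_measurable M"
    unfolding R_def using X_meas Z_meas[OF t(1)] by measurable
  show int: "integrable M (\<lambda>\<omega>. (norm (R \<omega>))\<^sup>2)"
    using R_meas le by (intro integrableI_bounded) (auto simp: less_top[symmetric] top_unique)
  show "expectation (\<lambda>\<omega>. (norm (R \<omega>))\<^sup>2) \<le> C * t ^ 3"
    using le C t by (subst (asm) nn_integral_eq_integral[OF int]) auto
qed

text \<open>
  In the expansion of \<open>(norm (X t))\<^sup>2 / 2\<close>, mean zero removes the terms linear in \<open>Z t\<close> and the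
  variance of \<open>Z t\<close> produces \<open>v / 2\<close>.  The error \<open>E\<close> collects all terms that contain the remainder, together with the square of the drift
  displacement; its mean is \<open>o(t)\<close>.
\<close>

lemma (in prob_space) additive_noise_square_generator:
  fixes X Z :: "real \<Rightarrow> 'a \<Rightarrow> 'e::euclidean_space"
  assumes lip: "L-lipschitz_on UNIV b"
    and X_meas: "\<And>t. 0 \<le> t \<Longrightarrow> X t \<in> borel_measurable M"
    and Z_meas: "\<And>t. 0 \<le> t \<Longrightarrow> Z t \<in> borel_measurable M"
    and X_cont: "AE \<omega> in M. continuous_on {0..} (\<lambda>t. X t \<omega>)"
    and Z_cont: "AE \<omega> in M. continuous_on {0..} (\<lambda>t. Z t \<omega>)"
    and eq: "AE \<omega> in M. \<forall>t\<ge>0. X t \<omega> = w + integral {0..t} (\<lambda>r. b (X r \<omega>)) + Z t \<omega>"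
    and Z_mean: "\<And>t c. 0 \<le> t \<Longrightarrow> expectation (\<lambda>\<omega>. c \<bullet> Z t \<omega>) = 0"
    and Z_int: "\<And>t. 0 \<le> t \<Longrightarrow> integrable M (\<lambda>\<omega>. (norm (Z t \<omega>))\<^sup>2)"
    and Z_var: "\<And>t. 0 \<le> t \<Longrightarrow> expectation (\<lambda>\<omega>. (norm (Z t \<omega>))\<^sup>2) = v * t" and v: "0 \<le> v"
  shows "has_generator_value M (\<lambda>_. X) (\<lambda>y. (norm y)\<^sup>2 / 2) w (w \<bullet> b w + v / 2)"
proof -
  define a where "a = norm w + norm (b w)"
  define C where "C = 2 * (L * exp L)\<^sup>2 * ((norm (b w))\<^sup>2 + v)"
  have expansion: "integrable M (\<lambda>\<omega>. (norm (X t \<omega>))\<^sup>2 / 2) \<and>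
      \<bar>expectation (\<lambda>\<omega>. (norm (X t \<omega>))\<^sup>2 / 2) - (norm w)\<^sup>2 / 2 - t * (w \<bullet> b w + v / 2)\<bar>
        \<le> t * (a * (C + 1) / 2 * sqrt t + (norm (b w))\<^sup>2 / 2 * t + C / 2 * t\<^sup>2 + (C + v) / 2 * t)"
    if t: "0 < t" "t \<le> 1" for t
  proof -
    have t0: "0 \<le> t" using t by simp
    define R where "R \<omega> = X t \<omega> - w - t *\<^sub>R b w - Z t \<omega>" for \<omega>
    define E where "E \<omega> = (w + t *\<^sub>R b w) \<bullet> R \<omega> + t\<^sup>2 * (norm (b w))\<^sup>2 / 2 + (norm (R \<omega>))\<^sup>2 / 2
      + R \<omega> \<bullet> Z t \<omega>" for \<omega>
    have R_int: "integrable M (\<lambda>\<omega>. (norm (R \<omega>))\<^sup>2)"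
      and R_le: "expectation (\<lambda>\<omega>. (norm (R \<omega>))\<^sup>2) \<le> C * t ^ 3"
      unfolding R_def C_def
      using additive_noise_remainder_second_moment[OF t0 t(2) lip X_meas[OF t0] Z_meas X_cont Z_cont eq
          Z_int Z_var v] by auto
    have meas: "X t \<in> borel_measurable M" "Z t \<in> borel_measurable M" using X_meas Z_meas t0 by auto
    then have R_meas: "R \<in> borel_measurable M" unfolding R_def by measurable
    then have E_meas: "E \<in> borel_measurable M" unfolding E_def using meas by measurable
    have sq_X: "(norm (X t \<omega>))\<^sup>2 / 2 = ((norm w)\<^sup>2 / 2 + t * (w \<bullet> b w)) + (w + t *\<^sub>R b w) \<bullet> Z t \<omega>
        + (norm (Z t \<omega>))\<^sup>2 / 2 + E \<omega>" for \<omega>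
    proof -
      let ?c = "w + t *\<^sub>R b w"
      have sq_add: "(norm (x + y))\<^sup>2 = (norm x)\<^sup>2 + 2 * (x \<bullet> y) + (norm y)\<^sup>2" for x y :: 'e
        by (simp add: power2_norm_eq_inner inner_add_left inner_add_right inner_commute)
      have "X t \<omega> = (?c + R \<omega>) + Z t \<omega>" by (simp add: R_def)
      then have "(norm (X t \<omega>))\<^sup>2 = (norm ?c)\<^sup>2 + 2 * (?c \<bullet> R \<omega>) + (norm (R \<omega>))\<^sup>2
          + 2 * (?c \<bullet> Z t \<omega> + R \<omega> \<bullet> Z t \<omega>) + (norm (Z t \<omega>))\<^sup>2"
        by (simp only: sq_add inner_add_left[of ?c "R \<omega>"])
      moreover have "(norm ?c)\<^sup>2 = (norm w)\<^sup>2 + 2 * (t * (w \<bullet> b w)) + t\<^sup>2 * (norm (b w))\<^sup>2"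
        by (simp only: sq_add) (simp add: power_mult_distrib)
      ultimately show ?thesis unfolding E_def by (simp add: add_divide_distrib)
    qed
    \<comment> \<open>A majorant of \<open>E\<close> in which only the squares of \<open>R\<close> and \<open>Z\<close> occur.  The weights in
      \<open>x y \<le> (x\<^sup>2 / q + q y\<^sup>2) / 2\<close> balance the known orders: \<open>q = t * sqrt t\<close> for \<open>norm R\<close>
      against \<open>1\<close>, and \<open>q = t\<close> for \<open>norm R\<close> against \<open>norm Z\<close>.\<close>
    define D where "D \<omega> = a / 2 * ((norm (R \<omega>))\<^sup>2 / (t * sqrt t) + t * sqrt t)
      + t\<^sup>2 * (norm (b w))\<^sup>2 / 2 + (norm (R \<omega>))\<^sup>2 / 2 + ((norm (R \<omega>))\<^sup>2 / t + t * (norm (Z t \<omega>))\<^sup>2) / 2" for \<omega>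
    have amgm: "x * y \<le> (x\<^sup>2 / q + q * y\<^sup>2) / 2" if "0 < q" for x y q :: real
    proof -
      have "0 \<le> (x - q * y)\<^sup>2 / q" using that by simp
      also have "\<dots> = x\<^sup>2 / q + q * y\<^sup>2 - 2 * (x * y)"
        using that by (simp add: power2_eq_square field_simps)
      finally show ?thesis by simp
    qed
    have E_le: "\<bar>E \<omega>\<bar> \<le> D \<omega>" for \<omega>
    proof -
      have "\<bar>(w + t *\<^sub>R b w) \<bullet> R \<omega>\<bar> \<le> norm (w + t *\<^sub>R b w) * norm (R \<omega>)" by (rule Cauchy_Schwarz_ineq2)
      also have "norm (w + t *\<^sub>R b w) \<le> a"
        unfolding a_def using t by (intro order.trans[OF norm_triangle_ineq]) (auto simp: mult_left_le_one_le)
      also have "norm (R \<omega>) \<le> ((norm (R \<omega>))\<^sup>2 / (t * sqrt t) + t * sqrt t) / 2"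
        using amgm[of "t * sqrt t" "norm (R \<omega>)" 1] t by simp
      finally have 1: "\<bar>(w + t *\<^sub>R b w) \<bullet> R \<omega>\<bar> \<le> a / 2 * ((norm (R \<omega>))\<^sup>2 / (t * sqrt t) + t * sqrt t)"
        by (simp add: mult_left_mono mult_right_mono a_def)
      have "\<bar>R \<omega> \<bullet> Z t \<omega>\<bar> \<le> norm (R \<omega>) * norm (Z t \<omega>)" by (rule Cauchy_Schwarz_ineq2)
      also have "\<dots> \<le> ((norm (R \<omega>))\<^sup>2 / t + t * (norm (Z t \<omega>))\<^sup>2) / 2" by (rule amgm[OF t(1)])
      finally have 2: "\<bar>R \<omega> \<bullet> Z t \<omega>\<bar> \<le> ((norm (R \<omega>))\<^sup>2 / t + t * (norm (Z t \<omega>))\<^sup>2) / 2" .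
      have 3: "0 \<le> t\<^sup>2 * (norm (b w))\<^sup>2 / 2" "0 \<le> (norm (R \<omega>))\<^sup>2 / 2" by auto
      show ?thesis using 1 2 3 unfolding E_def D_def by linarith
    qed
    have D_int: "integrable M D"
      unfolding D_def using R_int Z_int[OF t0] by auto
    have E_int: "integrable M E"
      using D_int E_meas E_le by (intro Bochner_Integration.integrable_bound[of M D E]) (auto intro!: AE_I2 order.trans[OF E_le])
    have lin_int: "integrable M (\<lambda>\<omega>. c \<bullet> Z t \<omega>)" for c
    proof (rule Bochner_Integration.integrable_bound)
      show "integrable M (\<lambda>\<omega>. (norm c)\<^sup>2 + (norm (Z t \<omega>))\<^sup>2)" using Z_int[OF t0] by auto
      show "(\<lambda>\<omega>. c \<bullet> Z t \<omega>) \<in> borel_measurable M" using meas by measurable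
      have "\<bar>c \<bullet> Z t \<omega>\<bar> \<le> (norm c)\<^sup>2 + (norm (Z t \<omega>))\<^sup>2" for \<omega>
        using Cauchy_Schwarz_ineq2[of c "Z t \<omega>"] amgm[of 1 "norm c" "norm (Z t \<omega>)"]
          zero_le_power2[of "norm c"] zero_le_power2[of "norm (Z t \<omega>)"] by simp
      then show "AE \<omega> in M. norm (c \<bullet> Z t \<omega>) \<le> norm ((norm c)\<^sup>2 + (norm (Z t \<omega>))\<^sup>2)" by auto
    qed
    have X_int: "integrable M (\<lambda>\<omega>. (norm (X t \<omega>))\<^sup>2 / 2)"
      unfolding sq_X using lin_int Z_int[OF t0] E_int by auto
    have "expectation (\<lambda>\<omega>. (norm (X t \<omega>))\<^sup>2 / 2) = (norm w)\<^sup>2 / 2 + t * (w \<bullet> b w) + v * t / 2 + expectation E"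
      unfolding sq_X using lin_int Z_int[OF t0] E_int Z_mean[OF t0] Z_var[OF t0]
      by (simp add: prob_space)
    moreover have "\<bar>expectation E\<bar> \<le> expectation D"
      by (rule order.trans[OF integral_abs_bound integral_mono[OF integrable_abs[OF E_int] D_int E_le]])
    moreover have "expectation D = a / 2 * (expectation (\<lambda>\<omega>. (norm (R \<omega>))\<^sup>2) / (t * sqrt t) + t * sqrt t)
        + t\<^sup>2 * (norm (b w))\<^sup>2 / 2 + expectation (\<lambda>\<omega>. (norm (R \<omega>))\<^sup>2) / 2
        + (expectation (\<lambda>\<omega>. (norm (R \<omega>))\<^sup>2) / t + t * (v * t)) / 2"
      unfolding D_def using R_int Z_int[OF t0] Z_var[OF t0] by (simp add: prob_space)
    moreover have "\<dots> \<le> a / 2 * (C * t ^ 3 / (t * sqrt t) + t * sqrt t)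
        + t\<^sup>2 * (norm (b w))\<^sup>2 / 2 + C * t ^ 3 / 2 + (C * t ^ 3 / t + t * (v * t)) / 2"
      using R_le t by (intro add_mono mult_left_mono divide_right_mono order_refl) (auto simp: a_def)
    moreover have "a / 2 * (C * t ^ 3 / (t * sqrt t) + t * sqrt t)
        + t\<^sup>2 * (norm (b w))\<^sup>2 / 2 + C * t ^ 3 / 2 + (C * t ^ 3 / t + t * (v * t)) / 2
      = t * (a * (C + 1) / 2 * sqrt t + (norm (b w))\<^sup>2 / 2 * t + C / 2 * t\<^sup>2 + (C + v) / 2 * t)"
    proof -
      have "t ^ 3 = (t * sqrt t) * (t * sqrt t)"
        using t by (simp add: power3_eq_cube mult_ac)
      then have 1: "C * t ^ 3 / (t * sqrt t) = C * (t * sqrt t)" using t by simp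
      have 2: "C * t ^ 3 / t = C * t\<^sup>2" using t by (simp add: power3_eq_cube power2_eq_square)
      show ?thesis unfolding 1 2
        by (simp add: power3_eq_cube power2_eq_square algebra_simps add_divide_distrib)
    qed
    moreover have "t * (w \<bullet> b w + v / 2) = t * (w \<bullet> b w) + v * t / 2" by (simp add: algebra_simps)
    ultimately have "\<bar>expectation (\<lambda>\<omega>. (norm (X t \<omega>))\<^sup>2 / 2) - (norm w)\<^sup>2 / 2 - t * (w \<bullet> b w + v / 2)\<bar>
        \<le> t * (a * (C + 1) / 2 * sqrt t + (norm (b w))\<^sup>2 / 2 * t + C / 2 * t\<^sup>2 + (C + v) / 2 * t)"
      by linarith
    with X_int show ?thesis by blast
  qed
  have near: "\<forall>\<^sub>F t in at_right (0::real). 0 < t \<and> t \<le> 1"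
    unfolding eventually_at_right_field by (intro exI[of _ 1]) auto
  have "((\<lambda>t. (expectation (\<lambda>\<omega>. (norm (X t \<omega>))\<^sup>2 / 2) - (norm w)\<^sup>2 / 2) / t - (w \<bullet> b w + v / 2))
      \<longlongrightarrow> 0) (at_right 0)"
  proof (rule Lim_null_comparison)
    show "((\<lambda>t. a * (C + 1) / 2 * sqrt t + (norm (b w))\<^sup>2 / 2 * t + C / 2 * t\<^sup>2 + (C + v) / 2 * t)
        \<longlongrightarrow> 0) (at_right 0)"
      by (auto intro!: tendsto_eq_intros)
    show "\<forall>\<^sub>F t in at_right 0. norm ((expectation (\<lambda>\<omega>. (norm (X t \<omega>))\<^sup>2 / 2) - (norm w)\<^sup>2 / 2) / t
        - (w \<bullet> b w + v / 2))
      \<le> a * (C + 1) / 2 * sqrt t + (norm (b w))\<^sup>2 / 2 * t + C / 2 * t\<^sup>2 + (C + v) / 2 * t"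
      using near
    proof eventually_elim
      fix t :: real assume t: "0 < t \<and> t \<le> 1"
      let ?d = "expectation (\<lambda>\<omega>. (norm (X t \<omega>))\<^sup>2 / 2) - (norm w)\<^sup>2 / 2"
      have "?d / t - (w \<bullet> b w + v / 2) = (?d - t * (w \<bullet> b w + v / 2)) / t"
        using t by (simp add: diff_divide_distrib)
      then show "norm (?d / t - (w \<bullet> b w + v / 2))
          \<le> a * (C + 1) / 2 * sqrt t + (norm (b w))\<^sup>2 / 2 * t + C / 2 * t\<^sup>2 + (C + v) / 2 * t"
        using expansion[of t] t by (simp add: pos_divide_le_eq mult.commute)
    qed
  qed
  then show ?thesis
    unfolding has_generator_value_def
    using eventually_mono[OF near expansion[THEN conjunct1]] by (auto simp: LIM_zero_iff)
qed

section \<open>Brownian noise and the linear drift\<close>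

lemma (in prob_space) brownian_motion_coordinate_moments:
  assumes B: "standard_brownian_motion M F B" and t: "0 \<le> t"
  shows "integrable M (\<lambda>\<omega>. (B t \<omega> - B 0 \<omega>) $ i)"
    and "expectation (\<lambda>\<omega>. (B t \<omega> - B 0 \<omega>) $ i) = 0"
    and "integrable M (\<lambda>\<omega>. ((B t \<omega> - B 0 \<omega>) $ i)\<^sup>2)"
    and "expectation (\<lambda>\<omega>. ((B t \<omega> - B 0 \<omega>) $ i)\<^sup>2) = t"
proof -
  let ?X = "\<lambda>\<omega>. (B t \<omega> - B 0 \<omega>) $ i"
  have "integrable M ?X \<and> expectation ?X = 0 \<and> integrable M (\<lambda>\<omega>. (?X \<omega>)\<^sup>2) \<and> expectation (\<lambda>\<omega>. (?X \<omega>)\<^sup>2) = t"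
  proof (cases "t = 0")
    case True
    then show ?thesis by simp
  next
    case False
    with t have s: "0 < sqrt t" "0 < t" by auto
    have D: "distributed M lborel ?X (normal_density 0 (sqrt t))"
      using B s unfolding standard_brownian_motion_def by fastforce
    have mean: "expectation ?X = 0" by (rule normal_distributed_expectation[OF s(1) D])
    have "integrable M ?X"
      using distributed_integrable[OF D, of "\<lambda>x. x"] integrable_normal_moment_nz_1[OF s(1)] by simp
    moreover have "integrable M (\<lambda>\<omega>. (?X \<omega>)\<^sup>2)"
      using distributed_integrable[OF D, of "\<lambda>x. x\<^sup>2"] integrable_normal_moment[OF s(1), of 0 2] by simp
    moreover have "expectation (\<lambda>\<omega>. (?X \<omega>)\<^sup>2) = t"
      using normal_distributed_variance[OF s(1) D] mean s by simp
    ultimately show ?thesis using mean by blast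
  qed
  then show "integrable M ?X" "expectation ?X = 0" "integrable M (\<lambda>\<omega>. (?X \<omega>)\<^sup>2)"
    "expectation (\<lambda>\<omega>. (?X \<omega>)\<^sup>2) = t" by auto
qed

text \<open>
  Differences of drift values are given by a linear map, and linear maps in finite dimension are
  bounded.
\<close>

lemma lipschitz_drift:
  fixes A :: "real ^ 'k ^ 'k" and \<Phi> :: "real ^ 'd"
  obtains L where "L-lipschitz_on UNIV (\<lambda>w. \<chi> k. drift \<alpha> \<gamma> A \<Phi> w k)"
proof -
  define T :: "real ^ 'd ^ 'k \<Rightarrow> real ^ 'd ^ 'k"
    where "T w = (\<chi> k. - \<alpha> *\<^sub>R w $ k - \<gamma> *\<^sub>R (\<Sum>j\<in>UNIV. A $ k $ j *\<^sub>R w $ j))" for w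
  have diff: "(\<chi> k. drift \<alpha> \<gamma> A \<Phi> w k) - (\<chi> k. drift \<alpha> \<gamma> A \<Phi> w' k) = T (w - w')" for w w'
    by (simp add: T_def drift_def vec_eq_iff algebra_simps sum_subtractf)
  have "linear T"
    by (rule linearI)
       (simp_all add: T_def vec_eq_iff algebra_simps sum.distrib sum_distrib_left)
  then obtain L where "L > 0" "\<And>w. norm (T w) \<le> L * norm w" using linear_bounded_pos by blast
  then show ?thesis
    by (intro that[of L] lipschitz_onI) (auto simp: dist_norm diff)
qed

lemma V_eq: "V w = (norm w)\<^sup>2 / 2"
  by (simp add: V_def power2_norm_eq_inner inner_vec_def[of w])

text \<open>The drift part of the generator, \<open>\<langle>\<nabla>V, b\<rangle>\<close>: the gradient of \<open>V\<close> at \<open>w\<close> is \<open>w\<close> itself.\<close>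

lemma inner_drift:
  "w \<bullet> (\<chi> k. drift \<alpha> \<gamma> A \<Phi> w k) =
    - 2 * \<alpha> * V w + \<gamma> * (\<Sum>k\<in>UNIV. \<Sum>j\<in>UNIV. A $ k $ j * ((w $ k) \<bullet> (\<Phi> - w $ j)))"
proof -
  have "w \<bullet> (\<chi> k. drift \<alpha> \<gamma> A \<Phi> w k) = (\<Sum>k\<in>UNIV. w $ k \<bullet> drift \<alpha> \<gamma> A \<Phi> w k)"
    by (simp add: inner_vec_def[of w])
  also have "\<dots> = (\<Sum>k\<in>UNIV. - \<alpha> * (norm (w $ k))\<^sup>2
      + \<gamma> * (\<Sum>j\<in>UNIV. A $ k $ j * ((w $ k) \<bullet> (\<Phi> - w $ j))))"
    by (simp only: drift_def inner_add_right inner_scaleR_right inner_sum_right power2_norm_eq_inner)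
  also have "\<dots> = - 2 * \<alpha> * V w + \<gamma> * (\<Sum>k\<in>UNIV. \<Sum>j\<in>UNIV. A $ k $ j * ((w $ k) \<bullet> (\<Phi> - w $ j)))"
    by (simp add: V_def sum.distrib sum_negf sum_distrib_left sum_subtractf)
  finally show ?thesis .
qed

section \<open>The generator applied to the quadratic function\<close>

theorem theorem3p3:
  fixes M :: "'a measure" and F :: "real \<Rightarrow> 'a measure"
    and B :: "'k::finite \<Rightarrow> real \<Rightarrow> 'a \<Rightarrow> real ^ 'd"
    and W :: "real ^ 'd ^ 'k \<Rightarrow> real \<Rightarrow> 'a \<Rightarrow> real ^ 'd ^ 'k"
    and A :: "real ^ 'k ^ 'k" and \<Phi> :: "real ^ 'd"
    and \<alpha>_self \<sigma>\<^sub>0 \<gamma> \<Phi>_max :: real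
  assumes "CARD('k) \<ge> 2"
    and "\<alpha>_self > 0" and "\<sigma>\<^sub>0 > 0" and "\<gamma> \<ge> 0"
    and "\<And>k j. A $ k $ j \<ge> 0" and "\<And>k. A $ k $ k = 0" and "\<And>k. (\<Sum>j\<in>UNIV. A $ k $ j) = 1"
    and "norm \<Phi> \<le> \<Phi>_max"
    and "prob_space M" and "usual_filtration M F"
    and "\<And>k. standard_brownian_motion M F (B k)" and "independent_processes M B"
    and "\<And>w. solves_sde M F B (drift \<alpha>_self \<gamma> A \<Phi>) \<sigma>\<^sub>0 w (W w)"
  shows "\<forall>w. has_generator_value M W V w
    (- 2 * \<alpha>_self * V w + \<gamma> * (\<Sum>k\<in>UNIV. \<Sum>j\<in>UNIV. A $ k $ j * ((w $ k) \<bullet> (\<Phi> - w $ j)))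
      + 1 / 2 * real CARD('k) * real CARD('d) * \<sigma>\<^sub>0\<^sup>2)"
proof
  fix w :: "real ^ 'd ^ 'k"
  interpret prob_space M by fact
  define b where "b x = (\<chi> k. drift \<alpha>_self \<gamma> A \<Phi> x k)" for x :: "real ^ 'd ^ 'k"
  define Z where "Z t \<omega> = (\<chi> k. \<sigma>\<^sub>0 *\<^sub>R (B k t \<omega> - B k 0 \<omega>))" for t \<omega>
  \<comment> \<open>The variance rate of the whole noise vector: \<open>\<sigma>\<^sub>0\<^sup>2\<close> for each of its scalar coordinates.\<close>
  define v where "v = real CARD('k) * real CARD('d) * \<sigma>\<^sub>0\<^sup>2"
  have B: "standard_brownian_motion M F (B k)" for k by fact
  have sde: "solves_sde M F B (drift \<alpha>_self \<gamma> A \<Phi>) \<sigma>\<^sub>0 w (W w)" by fact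
  obtain L where lip: "L-lipschitz_on UNIV b"
    unfolding b_def by (rule lipschitz_drift)
  have sub: "subalgebra M (F t)" if "0 \<le> t" for t
    using \<open>usual_filtration M F\<close> that by (simp add: usual_filtration_def)
  have W_meas: "W w t \<in> borel_measurable M" if "0 \<le> t" for t
    using sde that by (auto simp: solves_sde_def adapted_def intro: measurable_from_subalg[OF sub])
  have B_meas: "B k t \<in> borel_measurable M" if "0 \<le> t" for k t
    using B that
    by (auto simp: standard_brownian_motion_def adapted_def intro: measurable_from_subalg[OF sub])
  have Z_meas: "Z t \<in> borel_measurable M" if "0 \<le> t" for t
  proof (subst borel_measurable_euclidean_space, intro ballI)
    fix e :: "real ^ 'd ^ 'k" assume "e \<in> Basis"
    then obtain k u where "e = axis k u" by (auto simp: Basis_vec_def)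
    moreover have "(\<lambda>\<omega>. (\<sigma>\<^sub>0 *\<^sub>R (B k t \<omega> - B k 0 \<omega>)) \<bullet> u) \<in> borel_measurable M"
      using B_meas[OF that, of k] B_meas[of 0 k] by measurable
    ultimately show "(\<lambda>\<omega>. Z t \<omega> \<bullet> e) \<in> borel_measurable M" by (simp add: Z_def inner_axis)
  qed
  have W_cont: "AE \<omega> in M. continuous_on {0..} (\<lambda>t. W w t \<omega>)"
    using sde by (simp add: solves_sde_def as_continuous_def)
  have "AE \<omega> in M. \<forall>k. continuous_on {0..} (\<lambda>t. B k t \<omega>)"
    using B by (simp add: AE_all_countable standard_brownian_motion_def as_continuous_def)
  then have Z_cont: "AE \<omega> in M. continuous_on {0..} (\<lambda>t. Z t \<omega>)"
    unfolding Z_def by eventually_elim (auto intro!: continuous_intros)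
  have "AE \<omega> in M. W w 0 \<omega> = w"
    "AE \<omega> in M. \<forall>t\<ge>0. \<forall>k. W w t \<omega> $ k = W w 0 \<omega> $ k
      + integral {0..t} (\<lambda>s. drift \<alpha>_self \<gamma> A \<Phi> (W w s \<omega>) k) + \<sigma>\<^sub>0 *\<^sub>R (B k t \<omega> - B k 0 \<omega>)"
    using sde by (simp_all add: solves_sde_def)
  then have eq: "AE \<omega> in M. \<forall>t\<ge>0. W w t \<omega> = w + integral {0..t} (\<lambda>s. b (W w s \<omega>)) + Z t \<omega>"
    using W_cont
  proof eventually_elim
    case (elim \<omega>)
    have "integral {0..t} (\<lambda>s. b (W w s \<omega>)) $ k = integral {0..t} (\<lambda>s. drift \<alpha>_self \<gamma> A \<Phi> (W w s \<omega>) k)"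
      if "0 \<le> t" for t k
    proof -
      have "continuous_on {0..t} (\<lambda>s. W w s \<omega>)" using elim(3) by (rule continuous_on_subset) auto
      then have "(\<lambda>s. b (W w s \<omega>)) integrable_on {0..t}"
        by (intro integrable_continuous_real continuous_on_compose2[OF lipschitz_on_continuous_on[OF lip]]) auto
      from integral_linear[OF this bounded_linear_vec_nth[of k]] show ?thesis
        by (simp add: o_def b_def)
    qed
    moreover have "W w t \<omega> $ k = w $ k + integral {0..t} (\<lambda>s. drift \<alpha>_self \<gamma> A \<Phi> (W w s \<omega>) k) + Z t \<omega> $ k"
      if "0 \<le> t" for t k
      using elim(2)[rule_format, OF that, of k] unfolding elim(1) Z_def vec_lambda_beta .
    ultimately show ?case by (simp add: vec_eq_iff)
  qed
  note moments = brownian_motion_coordinate_moments[OF B]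
  have Z_mean: "expectation (\<lambda>\<omega>. c \<bullet> Z t \<omega>) = 0" if "0 \<le> t" for t and c :: "real ^ 'd ^ 'k"
  proof -
    have "c \<bullet> Z t \<omega> = (\<Sum>k\<in>UNIV. \<Sum>i\<in>UNIV. c $ k $ i * \<sigma>\<^sub>0 * (B k t \<omega> - B k 0 \<omega>) $ i)" for \<omega>
      by (simp add: Z_def inner_vec_def mult.assoc)
    then show ?thesis
      using moments(1,2)[OF that] by (simp del: vector_minus_component)
  qed
  have Z_sq: "(norm (Z t \<omega>))\<^sup>2 = (\<Sum>k\<in>UNIV. \<Sum>i\<in>UNIV. \<sigma>\<^sub>0\<^sup>2 * ((B k t \<omega> - B k 0 \<omega>) $ i)\<^sup>2)" for t \<omega>
    unfolding power2_norm_eq_inner inner_vec_def by (simp add: Z_def power2_eq_square mult_ac)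
  have Z_int: "integrable M (\<lambda>\<omega>. (norm (Z t \<omega>))\<^sup>2)" if "0 \<le> t" for t
    unfolding Z_sq using moments(3)[OF that] by (simp del: vector_minus_component)
  have Z_var: "expectation (\<lambda>\<omega>. (norm (Z t \<omega>))\<^sup>2) = v * t" if "0 \<le> t" for t
    unfolding Z_sq using moments(3,4)[OF that] by (simp del: vector_minus_component add: v_def mult_ac)
  have "0 \<le> v" by (simp add: v_def)
  from additive_noise_square_generator[OF lip W_meas Z_meas W_cont Z_cont eq Z_mean Z_int Z_var this]
  have "has_generator_value M (\<lambda>_. W w) (\<lambda>y. (norm y)\<^sup>2 / 2) w (w \<bullet> b w + v / 2)" .
  then show "has_generator_value M W V w
    (- 2 * \<alpha>_self * V w + \<gamma> * (\<Sum>k\<in>UNIV. \<Sum>j\<in>UNIV. A $ k $ j * ((w $ k) \<bullet> (\<Phi> - w $ j)))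
      + 1 / 2 * real CARD('k) * real CARD('d) * \<sigma>\<^sub>0\<^sup>2)"
    by (simp add: has_generator_value_def V_eq[abs_def] b_def inner_drift v_def)
qed

end
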